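(* Let $F$ be an $E$-adequate monoid where $E\subseteq E(F)$ is a right unitary subset, and let $M$ be a submonoid of $F$ such that: (1) whenever $t,x\in M$ and $e=tx$ satisfies $e=e^2\in E$, then $e=t^+x^*$; (2) there exist elements $a,b\in M$ such that (i) $b,ba,ba^2,\ldots$ are pairwise incomparable under the preorder $\leq_{\widetilde{\mathcal L}_E}$ of $F$; (ii) for each $i\ge0$ we have $M\cap(E_{i+1}\setminus E_i)\neq\emptyset$, where $E_i:=\{f\in E: fba^i=ba^i\}$. Then $M$ is not left coherent.
   Context: For a monoid $S$, $E(S)$ is the set of idempotents. Elements $a,b\in S$ are $\mathcal L^*$-related if for all $u,v\in S$: $au=av\iff bu=bv$; they are $\mathcal R^*$-related if for all $u,v\in S$: $ua=va\iff ub=vb$. Let $E\subseteq E(S)$. $S$ is left $E$-adequate if $E$ is a semilattice (a commutative subsemigroup of idempotents) and each $\mathcal R^*$-class of $S$ contains a (necessarily unique) idempotent of $E$; the idempotent of $E$ in the $\mathcal R^*$-class of $a$ is denoted $a^+$. Right $E$-adequate is defined dually with $\mathcal L^*$, the idempotent of $E$ in the $\mathcal L^*$-class of $a$ being $a^*$. $S$ is $E$-adequate if it is both left and right $E$-adequate. $E$ is right unitary in $S$ if $e,\,ae\in E$ implies $a\in E$ (for $a \in S$). The preorder $\leq_{\widetilde{\mathcal L}_E}$ is: $a\leq_{\widetilde{\mathcal L}_E}b$ iff $\{e\in E: be=b\}\subseteq\{e\in E: ae=a\}$. By convention $ba^0=b$. A left $S$-act over a monoid $S$ is a set with a unital associative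 left action of $S$. It is finitely presented if it is isomorphic to a quotient of a free left $S$-act on a finite set by a finitely generated left $S$-act congruence. $S$ is left coherent if every finitely generated subact of every finitely presented left $S$-act is finitely presented. *)

theory Defs
  imports "HOL-Algebra.Group" HOL.Hull
begin

section \<open>Adequate monoids\<close>

definition idempotents :: "('a, 'm) monoid_scheme \<Rightarrow> 'a set"
  where "idempotents S = {e \<in> carrier S. e \<otimes>\<^bsub>S\<^esub> e = e}"

definition L_star :: "('a, 'm) monoid_scheme \<Rightarrow> 'a \<Rightarrow> 'a \<Rightarrow> bool"
  where "L_star S a b \<longleftrightarrow>
    (\<forall>u\<in>carrier S. \<forall>v\<in>carrier S. a \<otimes>\<^bsub>S\<^esub> u = a \<otimes>\<^bsub>S\<^esub> v \<longleftrightarrow> b \<otimes>\<^bsub>S\<^esub> u = b \<otimes>\<^bsub>S\<^esub> v)"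

definition R_star :: "('a, 'm) monoid_scheme \<Rightarrow> 'a \<Rightarrow> 'a \<Rightarrow> bool"
  where "R_star S a b \<longleftrightarrow>
    (\<forall>u\<in>carrier S. \<forall>v\<in>carrier S. u \<otimes>\<^bsub>S\<^esub> a = v \<otimes>\<^bsub>S\<^esub> a \<longleftrightarrow> u \<otimes>\<^bsub>S\<^esub> b = v \<otimes>\<^bsub>S\<^esub> b)"

definition semilattice_of_idempotents :: "('a, 'm) monoid_scheme \<Rightarrow> 'a set \<Rightarrow> bool"
  where "semilattice_of_idempotents S E \<longleftrightarrow>
    E \<subseteq> idempotents S \<and>
    (\<forall>e\<in>E. \<forall>f\<in>E. e \<otimes>\<^bsub>S\<^esub> f \<in> E) \<and>
    (\<forall>e\<in>E. \<forall>f\<in>E. e \<otimes>\<^bsub>S\<^esub> f = f \<otimes>\<^bsub>S\<^esub> e)"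

definition left_adequate :: "('a, 'm) monoid_scheme \<Rightarrow> 'a set \<Rightarrow> bool"
  where "left_adequate S E \<longleftrightarrow>
    semilattice_of_idempotents S E \<and> (\<forall>a\<in>carrier S. \<exists>e\<in>E. R_star S a e)"

definition right_adequate :: "('a, 'm) monoid_scheme \<Rightarrow> 'a set \<Rightarrow> bool"
  where "right_adequate S E \<longleftrightarrow>
    semilattice_of_idempotents S E \<and> (\<forall>a\<in>carrier S. \<exists>e\<in>E. L_star S a e)"

definition adequate :: "('a, 'm) monoid_scheme \<Rightarrow> 'a set \<Rightarrow> bool"
  where "adequate S E \<longleftrightarrow> left_adequate S E \<and> right_adequate S E"

text \<open>\<open>plus_of S E a\<close> is \<open>a\<^sup>+\<close> and \<open>star_of S E a\<close> is \<open>a\<^sup>*\<close>; they are meaningful only when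
  \<open>S\<close> is left, respectively right, \<open>E\<close>-adequate.\<close>

definition plus_of :: "('a, 'm) monoid_scheme \<Rightarrow> 'a set \<Rightarrow> 'a \<Rightarrow> 'a"
  where "plus_of S E a = (THE e. e \<in> E \<and> R_star S a e)"

definition star_of :: "('a, 'm) monoid_scheme \<Rightarrow> 'a set \<Rightarrow> 'a \<Rightarrow> 'a"
  where "star_of S E a = (THE e. e \<in> E \<and> L_star S a e)"

lemma plus_of_props:
  assumes "monoid S" "left_adequate S E" "a \<in> carrier S"
  shows "plus_of S E a \<in> E" "R_star S a (plus_of S E a)"
proof -
  interpret monoid S by fact
  have idem: "e \<in> carrier S" "e \<otimes>\<^bsub>S\<^esub> e = e" if "e \<in> E" for e
    using that assms(2)
    unfolding left_adequate_def semilattice_of_idempotents_def idempotents_def by blast+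
  have comm: "e \<otimes>\<^bsub>S\<^esub> f = f \<otimes>\<^bsub>S\<^esub> e" if "e \<in> E" "f \<in> E" for e f
    using that assms(2) unfolding left_adequate_def semilattice_of_idempotents_def by blast
  have absorb: "e \<otimes>\<^bsub>S\<^esub> f = f" if "e \<in> E" "f \<in> E" "R_star S a e" "R_star S a f" for e f
  proof -
    have "e \<otimes>\<^bsub>S\<^esub> f = \<one>\<^bsub>S\<^esub> \<otimes>\<^bsub>S\<^esub> f \<longleftrightarrow> e \<otimes>\<^bsub>S\<^esub> e = \<one>\<^bsub>S\<^esub> \<otimes>\<^bsub>S\<^esub> e"
      using that(3,4) idem(1)[OF that(1)] one_closed unfolding R_star_def by blast
    then show ?thesis using idem that(1,2) by simp
  qed
  obtain e where e: "e \<in> E" "R_star S a e"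
    using assms unfolding left_adequate_def by blast
  have "\<exists>!e. e \<in> E \<and> R_star S a e"
  proof (rule ex1I[of _ e])
    show "f = e" if "f \<in> E \<and> R_star S a f" for f
      using that e absorb[of e f] absorb[of f e] comm[of e f] by simp
  qed (use e in blast)
  from theI'[OF this] show "plus_of S E a \<in> E" "R_star S a (plus_of S E a)"
    unfolding plus_of_def by blast+
qed

lemma star_of_props:
  assumes "monoid S" "right_adequate S E" "a \<in> carrier S"
  shows "star_of S E a \<in> E" "L_star S a (star_of S E a)"
proof -
  interpret monoid S by fact
  have idem: "e \<in> carrier S" "e \<otimes>\<^bsub>S\<^esub> e = e" if "e \<in> E" for e
    using that assms(2)
    unfolding right_adequate_def semilattice_of_idempotents_def idempotents_def by blast+
  have comm: "e \<otimes>\<^bsub>S\<^esub> f = f \<otimes>\<^bsub>S\<^esub> e" if "e \<in> E" "f \<in> E" for e f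
    using that assms(2) unfolding right_adequate_def semilattice_of_idempotents_def by blast
  have absorb: "f \<otimes>\<^bsub>S\<^esub> e = f" if "e \<in> E" "f \<in> E" "L_star S a e" "L_star S a f" for e f
  proof -
    have "f \<otimes>\<^bsub>S\<^esub> e = f \<otimes>\<^bsub>S\<^esub> \<one>\<^bsub>S\<^esub> \<longleftrightarrow> e \<otimes>\<^bsub>S\<^esub> e = e \<otimes>\<^bsub>S\<^esub> \<one>\<^bsub>S\<^esub>"
      using that(3,4) idem(1)[OF that(1)] one_closed unfolding L_star_def by blast
    then show ?thesis using idem that(1,2) by simp
  qed
  obtain e where e: "e \<in> E" "L_star S a e"
    using assms unfolding right_adequate_def by blast
  have "\<exists>!e. e \<in> E \<and> L_star S a e"
  proof (rule ex1I[of _ e])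
    show "f = e" if "f \<in> E \<and> L_star S a f" for f
      using that e absorb[of e f] absorb[of f e] comm[of e f] by simp
  qed (use e in blast)
  from theI'[OF this] show "star_of S E a \<in> E" "L_star S a (star_of S E a)"
    unfolding star_of_def by blast+
qed

definition right_unitary :: "('a, 'm) monoid_scheme \<Rightarrow> 'a set \<Rightarrow> bool"
  where "right_unitary S E \<longleftrightarrow>
    (\<forall>a\<in>carrier S. \<forall>e. e \<in> E \<and> a \<otimes>\<^bsub>S\<^esub> e \<in> E \<longrightarrow> a \<in> E)"

definition L_tilde_le :: "('a, 'm) monoid_scheme \<Rightarrow> 'a set \<Rightarrow> 'a \<Rightarrow> 'a \<Rightarrow> bool"
  where "L_tilde_le S E a b \<longleftrightarrow>
    {e \<in> E. b \<otimes>\<^bsub>S\<^esub> e = b} \<subseteq> {e \<in> E. a \<otimes>\<^bsub>S\<^esub> e = a}"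

section \<open>Acts over a monoid\<close>

locale left_act = monoid S for S :: "('a, 'm) monoid_scheme" (structure) +
  fixes A :: "'x set" and act :: "'a \<Rightarrow> 'x \<Rightarrow> 'x"
  assumes act_closed: "s \<in> carrier S \<Longrightarrow> x \<in> A \<Longrightarrow> act s x \<in> A"
    and act_one: "x \<in> A \<Longrightarrow> act \<one> x = x"
    and act_mult: "s \<in> carrier S \<Longrightarrow> t \<in> carrier S \<Longrightarrow> x \<in> A \<Longrightarrow> act (s \<otimes> t) x = act s (act t x)"

definition subact :: "('a, 'm) monoid_scheme \<Rightarrow> 'x set \<Rightarrow> ('a \<Rightarrow> 'x \<Rightarrow> 'x) \<Rightarrow> 'x set \<Rightarrow> bool"
  where "subact S A act B \<longleftrightarrow> B \<subseteq> A \<and> (\<forall>s\<in>carrier S. \<forall>x\<in>B. act s x \<in> B)"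

definition finitely_generated_subact ::
    "('a, 'm) monoid_scheme \<Rightarrow> 'x set \<Rightarrow> ('a \<Rightarrow> 'x \<Rightarrow> 'x) \<Rightarrow> 'x set \<Rightarrow> bool"
  where "finitely_generated_subact S A act B \<longleftrightarrow>
    (\<exists>G. finite G \<and> G \<subseteq> A \<and> B = subact S A act hull G)"

definition act_congruence ::
    "('a, 'm) monoid_scheme \<Rightarrow> 'x set \<Rightarrow> ('a \<Rightarrow> 'x \<Rightarrow> 'x) \<Rightarrow> ('x \<times> 'x) set \<Rightarrow> bool"
  where "act_congruence S A act r \<longleftrightarrow>
    equiv A r \<and> (\<forall>s\<in>carrier S. \<forall>(x, y)\<in>r. (act s x, act s y) \<in> r)"

definition finitely_generated_congruence ::
    "('a, 'm) monoid_scheme \<Rightarrow> 'x set \<Rightarrow> ('a \<Rightarrow> 'x \<Rightarrow> 'x) \<Rightarrow> ('x \<times> 'x) set \<Rightarrow> bool"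
  where "finitely_generated_congruence S A act r \<longleftrightarrow>
    (\<exists>H. finite H \<and> H \<subseteq> A \<times> A \<and> r = act_congruence S A act hull H)"

text \<open>On the quotient \<open>A // r\<close> the element \<open>s\<close> sends the class of \<open>x\<close> to the class of \<open>act s x\<close>.\<close>

definition quotient_act :: "('a \<Rightarrow> 'x \<Rightarrow> 'x) \<Rightarrow> ('x \<times> 'x) set \<Rightarrow> 'a \<Rightarrow> 'x set \<Rightarrow> 'x set"
  where "quotient_act act r s C = r `` (act s ` C)"

definition act_iso :: "('a, 'm) monoid_scheme \<Rightarrow> 'x set \<Rightarrow> ('a \<Rightarrow> 'x \<Rightarrow> 'x) \<Rightarrow>
    'y set \<Rightarrow> ('a \<Rightarrow> 'y \<Rightarrow> 'y) \<Rightarrow> ('x \<Rightarrow> 'y) \<Rightarrow> bool"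
  where "act_iso S A act B act' f \<longleftrightarrow>
    bij_betw f A B \<and> (\<forall>s\<in>carrier S. \<forall>x\<in>A. f (act s x) = act' s (f x))"

text \<open>The free left act on \<open>{..<n}\<close> is \<open>{..<n} \<times> S\<close>, a pair \<open>(i, t)\<close> standing for \<open>t \<cdot> i\<close>.\<close>

definition free_act_carrier :: "('a, 'm) monoid_scheme \<Rightarrow> nat \<Rightarrow> (nat \<times> 'a) set"
  where "free_act_carrier S n = {..<n} \<times> carrier S"

definition free_act :: "('a, 'm) monoid_scheme \<Rightarrow> 'a \<Rightarrow> nat \<times> 'a \<Rightarrow> nat \<times> 'a"
  where "free_act S s = (\<lambda>(i, t). (i, s \<otimes>\<^bsub>S\<^esub> t))"

definition finitely_presented ::
    "('a, 'm) monoid_scheme \<Rightarrow> 'x set \<Rightarrow> ('a \<Rightarrow> 'x \<Rightarrow> 'x) \<Rightarrow> bool"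
  where "finitely_presented S A act \<longleftrightarrow>
    (\<exists>n r f. finitely_generated_congruence S (free_act_carrier S n) (free_act S) r \<and>
      act_iso S (free_act_carrier S n // r) (quotient_act (free_act S) r) A act f)"

text \<open>HOL cannot quantify over the type of the elements of an act. Since every finitely presented
  act is isomorphic to one whose elements are congruence classes of a free act on some
  \<open>{..<n}\<close>, it suffices to quantify over acts on the type of such classes; the lemma
  \<open>left_coherentD\<close> below shows that nothing is lost.\<close>

definition left_coherent :: "('a, 'm) monoid_scheme \<Rightarrow> bool"
  where "left_coherent S \<longleftrightarrow>
    (\<forall>(A :: (nat \<times> 'a) set set) act B.
      left_act S A act \<and> finitely_presented S A act \<and> finitely_generated_subact S A act B \<longrightarrow>
      finitely_presented S B act)"

lemma left_act_free: "monoid S \<Longrightarrow> left_act S (free_act_carrier S n) (free_act S)"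
  unfolding left_act_def left_act_axioms_def free_act_carrier_def free_act_def
  by (auto simp: monoid.m_assoc monoid.l_one monoid.m_closed)

lemma act_congruence_hull:
  assumes "left_act S A act" "H \<subseteq> A \<times> A"
  shows "act_congruence S A act (act_congruence S A act hull H)"
proof -
  have top: "act_congruence S A act (A \<times> A)"
    using left_act.act_closed[OF assms(1)]
    by (auto simp: act_congruence_def equiv_def refl_on_def sym_def trans_def)
  let ?R = "act_congruence S A act hull H"
  have mem: "p \<in> ?R \<longleftrightarrow> (\<forall>t. act_congruence S A act t \<longrightarrow> H \<subseteq> t \<longrightarrow> p \<in> t)" for p
    by (auto simp: hull_def)
  have sub: "?R \<subseteq> A \<times> A" using assms(2) top by (rule hull_minimal)
  moreover have "refl_on A ?R"
    by (intro refl_onI) (simp add: mem act_congruence_def equiv_def refl_on_def)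
  moreover have "sym ?R"
    by (intro symI) (simp add: mem act_congruence_def equiv_def sym_def)
  moreover have "trans ?R"
  proof (intro transI)
    show "(x, z) \<in> ?R" if "(x, y) \<in> ?R" "(y, z) \<in> ?R" for x y z
      using that unfolding mem act_congruence_def equiv_def by (auto dest: transD)
  qed
  moreover have "(act s x, act s y) \<in> ?R" if "s \<in> carrier S" "(x, y) \<in> ?R" for s x y
    using that unfolding mem act_congruence_def by blast
  ultimately show ?thesis
    by (simp add: act_congruence_def[of S A act ?R] equiv_def[of A ?R] case_prod_unfold)
qed

lemma quotient_act_class:
  assumes "act_congruence S A act r" "s \<in> carrier S" "x \<in> A"
  shows "quotient_act act r s (r `` {x}) = r `` {act s x}"
proof -
  have eq: "equiv A r" and c: "\<And>y. (x, y) \<in> r \<Longrightarrow> (act s x, act s y) \<in> r"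
    using assms unfolding act_congruence_def by auto
  have x: "(x, x) \<in> r" using eq assms(3) by (auto simp: equiv_def refl_on_def)
  have cls: "r `` {act s y} = r `` {act s x}" if "(x, y) \<in> r" for y
    using equiv_class_eq[OF eq c[OF that]] by simp
  have "r `` (act s ` (r `` {x})) = (\<Union>y\<in>r `` {x}. r `` {act s y})" by blast
  also have "\<dots> = (\<Union>y\<in>r `` {x}. r `` {act s x})"
    by (rule SUP_cong) (simp_all add: cls)
  also have "\<dots> = r `` {act s x}" using x by (intro UN_constant_eq) auto
  finally show ?thesis by (simp add: quotient_act_def)
qed

lemma left_act_quotient:
  assumes "left_act S A act" "act_congruence S A act r"
  shows "left_act S (A // r) (quotient_act act r)"
proof -
  interpret left_act S A act by fact
  show ?thesis
  proof unfold_locales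
    fix s C assume s: "s \<in> carrier S" and "C \<in> A // r"
    then obtain x where x: "x \<in> A" "C = r `` {x}" by (auto elim: quotientE)
    then show "quotient_act act r s C \<in> A // r"
      using s by (simp add: quotient_act_class[OF assms(2)] quotientI act_closed)
  next
    fix C assume "C \<in> A // r"
    then obtain x where "x \<in> A" "C = r `` {x}" by (auto elim: quotientE)
    then show "quotient_act act r \<one>\<^bsub>S\<^esub> C = C"
      by (simp add: quotient_act_class[OF assms(2)] act_one)
  next
    fix s t C assume st: "s \<in> carrier S" "t \<in> carrier S" and "C \<in> A // r"
    then obtain x where "x \<in> A" "C = r `` {x}" by (auto elim: quotientE)
    then show "quotient_act act r (s \<otimes>\<^bsub>S\<^esub> t) C = quotient_act act r s (quotient_act act r t C)"
      using st by (simp add: quotient_act_class[OF assms(2)] act_mult act_closed)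
  qed
qed

lemma act_iso_comp:
  assumes "act_iso S A a B b f" "act_iso S B b C c g"
  shows "act_iso S A a C c (g \<circ> f)"
  using assms unfolding act_iso_def by (auto intro: bij_betw_trans simp: bij_betw_apply)

lemma hull_subact_image:
  assumes iso: "act_iso S A a B b f" and "left_act S A a" "G \<subseteq> A"
  shows "subact S B b hull (f ` G) = f ` (subact S A a hull G)"
proof
  interpret left_act S A a by fact
  have inj: "inj_on f A" and im: "f ` A = B"
    and hom: "\<And>s x. s \<in> carrier S \<Longrightarrow> x \<in> A \<Longrightarrow> f (a s x) = b s (f x)"
    using iso unfolding act_iso_def bij_betw_def by auto
  have A: "subact S A a A" using act_closed by (auto simp: subact_def)
  have HA: "subact S A a hull G \<subseteq> A" using A assms(3) by (rule hull_minimal[rotated])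
  have H: "subact S A a (subact S A a hull G)"
    unfolding subact_def[of S A a "subact S A a hull G"] using HA
    by (auto simp: hull_def subact_def)
  have "subact S B b (f ` (subact S A a hull G))"
    unfolding subact_def[of S B b "f ` (subact S A a hull G)"]
  proof (intro conjI ballI)
    show "f ` (subact S A a hull G) \<subseteq> B" using HA im by blast
    fix s y assume s: "s \<in> carrier S" and "y \<in> f ` (subact S A a hull G)"
    then obtain x where x: "x \<in> subact S A a hull G" "y = f x" by blast
    then have "b s y = f (a s x)" using hom[OF s, of x] HA by (simp add: subset_iff)
    moreover have "a s x \<in> subact S A a hull G"
      using H s x(1) unfolding subact_def[of S A a "subact S A a hull G"] by blast
    ultimately show "b s y \<in> f ` (subact S A a hull G)" by blast
  qed
  then show "subact S B b hull (f ` G) \<subseteq> f ` (subact S A a hull G)"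
    by (intro hull_minimal image_mono hull_subset)
  show "f ` (subact S A a hull G) \<subseteq> subact S B b hull (f ` G)"
    unfolding hull_def[of "subact S B b"]
  proof (intro Inter_greatest)
    fix U assume "U \<in> {t. subact S B b t \<and> f ` G \<subseteq> t}"
    then have "subact S A a hull G \<subseteq> {x \<in> A. f x \<in> U}"
      using assms(3) act_closed hom by (intro hull_minimal) (auto simp: subact_def)
    then show "f ` (subact S A a hull G) \<subseteq> U" by blast
  qed
qed

lemma left_coherentD:
  fixes A :: "'x set"
  assumes "monoid S" "left_coherent S"
    and fp: "finitely_presented S A act" and fg: "finitely_generated_subact S A act B"
  shows "finitely_presented S B act"
proof -
  obtain n r f where r: "finitely_generated_congruence S (free_act_carrier S n) (free_act S) r"
    and f: "act_iso S (free_act_carrier S n // r) (quotient_act (free_act S) r) A act f"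
    using fp unfolding finitely_presented_def by blast
  define Q q where "Q = free_act_carrier S n // r" and "q = quotient_act (free_act S) r"
  note f = f[folded Q_def q_def]
  have bij: "bij_betw f Q A" using f by (simp add: act_iso_def)
  have Q: "left_act S Q q"
    unfolding Q_def q_def using r left_act_free[OF assms(1)]
    by (auto simp: finitely_generated_congruence_def intro!: left_act_quotient act_congruence_hull)
  obtain G where G: "finite G" "G \<subseteq> A" "B = subact S A act hull G"
    using fg unfolding finitely_generated_subact_def by blast
  obtain G' where G': "G' \<subseteq> Q" "G = f ` G'" "finite G'"
    using finite_subset_image[OF G(1), of f Q] G(2) bij by (auto simp: bij_betw_def)
  define B' where "B' = subact S Q q hull G'"
  have B: "B = f ` B'"
    using hull_subact_image[OF f Q G'(1)] G(3) G'(2) by (simp add: B'_def)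
  have B'Q: "B' \<subseteq> Q"
    unfolding B'_def using G'(1) left_act.act_closed[OF Q]
    by (intro hull_minimal) (auto simp: subact_def)
  have "act_iso S Q q Q q id" by (simp add: act_iso_def)
  then have "finitely_presented S Q q"
    using r unfolding finitely_presented_def Q_def q_def by blast
  moreover have "finitely_generated_subact S Q q B'"
    using G' by (auto simp: finitely_generated_subact_def B'_def)
  ultimately have "finitely_presented S B' q"
    using assms(2) Q unfolding left_coherent_def by blast
  moreover have "act_iso S B' q B act f"
    using f B B'Q by (auto simp: act_iso_def bij_betw_def intro: inj_on_subset)
  ultimately show ?thesis
    unfolding finitely_presented_def by (blast intro: act_iso_comp)
qed

end

theory Submission
  imports Defs
begin

text \<open>Let \<open>\<rho>\<close> be the left congruence on \<open>M\<close> generated by the single pair \<open>(\<one>, a)\<close>. Two elements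
  \<open>u\<close> and \<open>v\<close> are \<open>\<rho>\<close>-related iff \<open>u a\<^sup>i = v a\<^sup>j\<close> for some \<open>i\<close> and \<open>j\<close>
  (\<open>tail_congruence_eq_hull\<close>), so the finitely presented act \<open>M/\<rho>\<close> identifies all the
  elements \<open>b a\<^sup>i\<close>. The subact generated by the class of \<open>b\<close> is not finitely presented.

  Every relation \<open>u [b] = v [b]\<close> in this subact already appears at some level \<open>n\<close>, as an equation
  \<open>u b a\<^sup>n = v b a\<^sup>m\<close> in \<open>M\<close>. A finite set of relations thus appears below one common level
  \<open>n\<close>. The incomparability of the \<open>b a\<^sup>i\<close> keeps this level rigid: \<open>b a\<^sup>n = t b a\<^sup>m\<close>
  forces \<open>n = m\<close>, because a left multiple of \<open>y\<close> always lies below \<open>y\<close>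
  (\<open>L_tilde_le_left_mult\<close>). Let \<open>T\<close> be the set of all \<open>t\<close> with
  \<open>t b a\<^sup>n = b a\<^sup>n\<close>. If \<open>u [b] = v [b]\<close> is one of the finitely many relations, then
  \<open>c u \<in> T\<close> iff \<open>c v \<in> T\<close>, for every \<open>c \<in> M\<close>; hence no consequence of these relations
  leads out of \<open>T\<close> (\<open>congruence_hull_saturated\<close>). But an element
  \<open>f\<close> of \<open>M \<inter> (E\<^sub>n\<^sub>+\<^sub>1 - E\<^sub>n)\<close> gives the true relation \<open>\<one> [b] = f [b]\<close>, and
  \<open>\<one> \<in> T\<close> while \<open>f \<notin> T\<close>.

  The argument is carried out in \<open>not_left_coherent_if_rigid_powers\<close> for an arbitrary monoid. An
  arbitrary finite presentation of the subact need not have \<open>[b]\<close> among its generators, so there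
  the generators are written as \<open>w\<^sub>k [b]\<close> and \<open>T\<close> is pulled back along
  \<open>(k, t) \<mapsto> t w\<^sub>k\<close>.\<close>

section \<open>Congruences on acts and saturated sets\<close>

text \<open>The pairs that no translate can separate by means of a set \<open>T\<close> form a congruence, the
  syntactic congruence of \<open>T\<close>; it contains the generators, hence everything they generate.\<close>

lemma congruence_hull_saturated:
  assumes "left_act S A act" "H \<subseteq> A \<times> A"
    and gen: "\<And>x y t. (x, y) \<in> H \<Longrightarrow> t \<in> carrier S \<Longrightarrow> act t x \<in> T \<longleftrightarrow> act t y \<in> T"
    and xy: "(x, y) \<in> act_congruence S A act hull H"
  shows "x \<in> T \<longleftrightarrow> y \<in> T"
proof -
  interpret left_act S A act by fact
  define \<theta> where
    "\<theta> = {(x, y). x \<in> A \<and> y \<in> A \<and> (\<forall>t\<in>carrier S. act t x \<in> T \<longleftrightarrow> act t y \<in> T)}"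
  have "equiv A \<theta>"
    by (auto simp: \<theta>_def equiv_def refl_on_def sym_def trans_def)
  moreover have "(act s x, act s y) \<in> \<theta>" if "s \<in> carrier S" "(x, y) \<in> \<theta>" for s x y
    using that by (auto simp: \<theta>_def act_closed simp flip: act_mult)
  ultimately have "act_congruence S A act \<theta>"
    by (auto simp: act_congruence_def)
  moreover have "H \<subseteq> \<theta>"
    using assms(2) gen by (auto simp: \<theta>_def)
  ultimately have "(x, y) \<in> \<theta>"
    using xy hull_minimal by blast
  then show ?thesis
    by (auto simp: \<theta>_def act_one dest: bspec[OF _ one_closed])
qed

section \<open>The left congruence generated by one pair with an identity\<close>

text \<open>The carrier \<open>{..<1} \<times> S\<close> of the free act on one generator is a copy of \<open>S\<close>, hence the
  index \<open>0\<close> in each pair.\<close>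

definition tail_congruence ::
    "('a, 'm) monoid_scheme \<Rightarrow> 'a \<Rightarrow> ((nat \<times> 'a) \<times> (nat \<times> 'a)) set"
  where "tail_congruence S a = {((0, u), (0, v)) | u v.
    u \<in> carrier S \<and> v \<in> carrier S \<and>
    (\<exists>(i :: nat) (j :: nat). u \<otimes>\<^bsub>S\<^esub> a [^]\<^bsub>S\<^esub> i = v \<otimes>\<^bsub>S\<^esub> a [^]\<^bsub>S\<^esub> j)}"

context monoid
begin

lemma mult_pow_add:
  assumes "x \<in> carrier G" "a \<in> carrier G"
  shows "x \<otimes> a [^] (i + j :: nat) = x \<otimes> a [^] i \<otimes> a [^] j"
  using assms by (simp add: m_assoc flip: nat_pow_mult)

text \<open>Stated with a filter because filters are closed under finite intersections: finitely many
  related pairs can then be inspected at one common exponent.\<close>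

lemma eventually_common_tail:
  assumes "x \<in> carrier G" "y \<in> carrier G" "a \<in> carrier G"
    and eq: "x \<otimes> a [^] (i :: nat) = y \<otimes> a [^] (j :: nat)"
  shows "\<forall>\<^sub>F n in sequentially. \<exists>m :: nat. x \<otimes> a [^] n = y \<otimes> a [^] m"
proof (rule eventually_sequentiallyI[of i])
  fix n assume "i \<le> n"
  then obtain k where "n = i + k" by (auto simp: le_iff_add)
  then have "x \<otimes> a [^] n = y \<otimes> a [^] (j + k)"
    using assms by (simp add: mult_pow_add)
  then show "\<exists>m :: nat. x \<otimes> a [^] n = y \<otimes> a [^] m" ..
qed

lemma act_congruence_tail_congruence:
  assumes a: "a \<in> carrier G"
  shows "act_congruence G (free_act_carrier G 1) (free_act G) (tail_congruence G a)"
proof -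
  let ?\<rho> = "tail_congruence G a"
  have "trans ?\<rho>"
  proof (rule transI)
    fix x y z assume "(x, y) \<in> ?\<rho>" "(y, z) \<in> ?\<rho>"
    then obtain u v w and i j k l :: nat
      where xz: "x = (0, u)" "z = (0, w)"
        and car: "u \<in> carrier G" "v \<in> carrier G" "w \<in> carrier G"
        and eq: "u \<otimes> a [^] i = v \<otimes> a [^] j" "v \<otimes> a [^] k = w \<otimes> a [^] l"
      unfolding tail_congruence_def by blast
    have "u \<otimes> a [^] (i + k) = v \<otimes> a [^] (k + j)"
      using car a eq(1) by (simp add: mult_pow_add add.commute[of k])
    also have "\<dots> = w \<otimes> a [^] (l + j)"
      using car a eq(2) by (simp add: mult_pow_add)
    finally show "(x, z) \<in> ?\<rho>"
      using xz car unfolding tail_congruence_def by blast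
  qed
  moreover have "sym ?\<rho>"
    unfolding sym_def tail_congruence_def by (auto intro: sym)
  moreover have "refl_on (free_act_carrier G 1) ?\<rho>" "?\<rho> \<subseteq> free_act_carrier G 1 \<times> free_act_carrier G 1"
    by (auto simp: refl_on_def tail_congruence_def free_act_carrier_def)
  moreover have "(free_act G s x, free_act G s y) \<in> ?\<rho>"
    if "s \<in> carrier G" "(x, y) \<in> ?\<rho>" for s x y
  proof -
    from that(2) obtain u v and i j :: nat
      where xy: "x = (0, u)" "y = (0, v)" and car: "u \<in> carrier G" "v \<in> carrier G"
        and eq: "u \<otimes> a [^] i = v \<otimes> a [^] j"
      unfolding tail_congruence_def by blast
    have "s \<otimes> u \<otimes> a [^] i = s \<otimes> v \<otimes> a [^] j"
      using that(1) car a eq by (simp add: m_assoc)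
    then show ?thesis
      using that(1) car unfolding xy free_act_def tail_congruence_def by auto
  qed
  ultimately show ?thesis
    by (auto simp: act_congruence_def equiv_def)
qed

lemma tail_congruence_eq_hull:
  assumes a: "a \<in> carrier G"
  shows "tail_congruence G a =
    act_congruence G (free_act_carrier G 1) (free_act G) hull {((0, \<one>), (0, a))}"
    (is "?\<rho> = ?R")
proof
  have gen: "{((0, \<one>), (0, a))} \<subseteq> ?\<rho>"
  proof -
    have "\<one> \<otimes> a [^] (1 :: nat) = a \<otimes> a [^] (0 :: nat)"
      using a by simp
    then show ?thesis
      using a unfolding tail_congruence_def by blast
  qed
  with act_congruence_tail_congruence[OF a] show "?R \<subseteq> ?\<rho>"
    by (intro hull_minimal)
  have cong: "act_congruence G (free_act_carrier G 1) (free_act G) ?R"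
    using a by (intro act_congruence_hull left_act_free) (auto simp: free_act_carrier_def monoid_axioms)
  then have refl: "((0, u), (0, u)) \<in> ?R" if "u \<in> carrier G" for u
    using that unfolding act_congruence_def equiv_def refl_on_def free_act_carrier_def by auto
  have sym: "sym ?R" and trans: "trans ?R"
    using cong unfolding act_congruence_def equiv_def by auto
  have step: "((0, u), (0, u \<otimes> a)) \<in> ?R" if "u \<in> carrier G" for u
  proof -
    have "((0, \<one>), (0, a)) \<in> ?R"
      by (rule subsetD[OF hull_subset]) simp
    then have "(free_act G u (0, \<one>), free_act G u (0, a)) \<in> ?R"
      using cong that unfolding act_congruence_def by blast
    then show ?thesis
      using that by (simp add: free_act_def)
  qed
  have power: "((0, u), (0, u \<otimes> a [^] i)) \<in> ?R" if "u \<in> carrier G" for u and i :: nat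
  proof (induction i)
    case 0
    then show ?case using that refl by simp
  next
    case (Suc i)
    have "((0, u \<otimes> a [^] i), (0, u \<otimes> a [^] Suc i)) \<in> ?R"
      using step[of "u \<otimes> a [^] i"] that a by (simp add: m_assoc)
    with Suc show ?case
      by (rule transD[OF trans])
  qed
  show "?\<rho> \<subseteq> ?R"
  proof
    fix p assume "p \<in> ?\<rho>"
    then obtain u v and i j :: nat
      where p: "p = ((0, u), (0, v))" and car: "u \<in> carrier G" "v \<in> carrier G"
        and eq: "u \<otimes> a [^] i = v \<otimes> a [^] j"
      unfolding tail_congruence_def by blast
    have "((0, u \<otimes> a [^] i), (0, v)) \<in> ?R"
      using power[OF car(2), of j] symD[OF sym] eq by simp
    with power[OF car(1), of i] show "p \<in> ?R"
      unfolding p by (rule transD[OF trans])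
  qed
qed

section \<open>A criterion for failure of left coherence\<close>

text \<open>The assumption \<open>new\<close> provides, for every \<open>n\<close>, a relation on the class of \<open>b\<close> that
  becomes an equation in the monoid only after multiplication by \<open>a\<close> at least \<open>n + 1\<close> times;
  \<open>rigid\<close> prevents finitely many relations from producing all of these.\<close>

theorem not_left_coherent_if_rigid_powers:
  assumes a: "a \<in> carrier G" and b: "b \<in> carrier G"
    and rigid: "\<And>(n :: nat) (m :: nat) t.
      t \<in> carrier G \<Longrightarrow> b \<otimes> a [^] n = t \<otimes> (b \<otimes> a [^] m) \<Longrightarrow> n = m"
    and new: "\<And>n :: nat. \<exists>f\<in>carrier G.
      f \<otimes> (b \<otimes> a [^] Suc n) = b \<otimes> a [^] Suc n \<and> f \<otimes> (b \<otimes> a [^] n) \<noteq> b \<otimes> a [^] n"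
  shows "\<not> left_coherent G"
proof
  assume coherent: "left_coherent G"
  define \<rho> where "\<rho> = tail_congruence G a"
  define C where "C = free_act_carrier G 1"
  define Q where "Q = C // \<rho>"
  define q where "q = quotient_act (free_act G) \<rho>"
  define cls where "cls u = \<rho> `` {(0, u)}" for u
  have cong: "act_congruence G C (free_act G) \<rho>"
    unfolding C_def \<rho>_def using a by (rule act_congruence_tail_congruence)
  have C: "(0, u) \<in> C" if "u \<in> carrier G" for u
    using that by (simp add: C_def free_act_carrier_def)
  have q_cls: "q s (cls u) = cls (s \<otimes> u)" if "s \<in> carrier G" "u \<in> carrier G" for s u
    using quotient_act_class[OF cong that(1) C[OF that(2)]]
    by (simp add: q_def cls_def free_act_def)
  have cls_eq: "cls u = cls v \<longleftrightarrow> (\<exists>(i :: nat) (j :: nat). u \<otimes> a [^] i = v \<otimes> a [^] j)"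
    if "u \<in> carrier G" "v \<in> carrier G" for u v
  proof -
    have "cls u = cls v \<longleftrightarrow> ((0, u), (0, v)) \<in> \<rho>"
      unfolding cls_def using cong that C
      by (intro eq_equiv_class_iff[of C]) (auto simp: act_congruence_def)
    then show ?thesis
      using that by (auto simp: \<rho>_def tail_congruence_def)
  qed

  define B where "B = subact G Q q hull {cls b}"
  have cls_Q: "cls u \<in> Q" if "u \<in> carrier G" for u
    unfolding cls_def Q_def using C[OF that] by (rule quotientI)
  have "finitely_generated_congruence G C (free_act G) \<rho>"
    unfolding finitely_generated_congruence_def C_def \<rho>_def
    using a by (intro exI[of _ "{((0, \<one>), (0, a))}"])
      (auto simp: tail_congruence_eq_hull free_act_carrier_def)
  moreover have "act_iso G Q q Q q id"
    by (simp add: act_iso_def)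
  ultimately have "finitely_presented G Q q"
    unfolding finitely_presented_def Q_def q_def C_def by blast
  moreover have "finitely_generated_subact G Q q B"
    unfolding finitely_generated_subact_def B_def using cls_Q[OF b]
    by (intro exI[of _ "{cls b}"]) simp
  ultimately have "finitely_presented G B q"
    by (rule left_coherentD[OF monoid_axioms coherent])
  then obtain n r \<phi> where r: "finitely_generated_congruence G (free_act_carrier G n) (free_act G) r"
    and \<phi>: "act_iso G (free_act_carrier G n // r) (quotient_act (free_act G) r) B q \<phi>"
    unfolding finitely_presented_def by blast
  define N where "N = free_act_carrier G n"
  note r = r[folded N_def] and \<phi> = \<phi>[folded N_def]
  have N: "(k, t) \<in> N \<longleftrightarrow> k < n \<and> t \<in> carrier G" for k t
    by (simp add: N_def free_act_carrier_def)
  have free: "left_act G N (free_act G)"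
    unfolding N_def by (rule left_act_free) (rule monoid_axioms)
  obtain H where H: "finite H" "H \<subseteq> N \<times> N" "r = act_congruence G N (free_act G) hull H"
    using r unfolding finitely_generated_congruence_def by blast
  have r_cong: "act_congruence G N (free_act G) r"
    unfolding H(3) using free H(2) by (rule act_congruence_hull)
  have r_equiv: "equiv N r"
    using r_cong by (simp add: act_congruence_def)
  have \<phi>_bij: "bij_betw \<phi> (N // r) B"
    using \<phi> by (simp add: act_iso_def)

  have B_elem: "\<exists>w\<in>carrier G. x = cls (w \<otimes> b)" if "x \<in> B" for x
  proof -
    have "subact G Q q {cls (w \<otimes> b) | w. w \<in> carrier G}"
      unfolding subact_def
    proof (intro conjI ballI)
      show "{cls (w \<otimes> b) | w. w \<in> carrier G} \<subseteq> Q"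
        using b cls_Q by auto
      fix s x assume "s \<in> carrier G" and "x \<in> {cls (w \<otimes> b) | w. w \<in> carrier G}"
      then obtain w where "w \<in> carrier G" "x = cls (w \<otimes> b)" by blast
      then have "q s x = cls (s \<otimes> w \<otimes> b)" "s \<otimes> w \<in> carrier G"
        using b \<open>s \<in> carrier G\<close> by (simp_all add: q_cls m_assoc)
      then show "q s x \<in> {cls (w \<otimes> b) | w. w \<in> carrier G}" by blast
    qed
    moreover have "{cls b} \<subseteq> {cls (w \<otimes> b) | w. w \<in> carrier G}"
      using b by (auto intro: exI[of _ \<one>])
    ultimately have "B \<subseteq> {cls (w \<otimes> b) | w. w \<in> carrier G}"
      unfolding B_def by (rule hull_minimal[rotated])
    then show ?thesis using that by blast
  qed
  have "\<exists>w\<in>carrier G. \<phi> (r `` {(k, \<one>)}) = cls (w \<otimes> b)" if "k < n" for k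
    using that by (intro B_elem bij_betw_apply[OF \<phi>_bij] quotientI) (simp add: N)
  then obtain w where w: "\<And>k. k < n \<Longrightarrow> w k \<in> carrier G"
    and \<phi>_w: "\<And>k. k < n \<Longrightarrow> \<phi> (r `` {(k, \<one>)}) = cls (w k \<otimes> b)"
    by metis
  have \<phi>_cls: "\<phi> (r `` {(k, t)}) = cls (t \<otimes> w k \<otimes> b)" if "k < n" "t \<in> carrier G" for k t
  proof -
    have "r `` {(k, t)} = quotient_act (free_act G) r t (r `` {(k, \<one>)})"
      using that quotient_act_class[OF r_cong that(2), of "(k, \<one>)"]
      by (simp add: N free_act_def)
    also have "\<phi> \<dots> = q t (\<phi> (r `` {(k, \<one>)}))"
      using \<phi> that by (simp add: act_iso_def N quotientI)
    finally show ?thesis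
      using that w b by (simp add: \<phi>_w q_cls m_assoc)
  qed
  have r_iff: "((k, t), (l, s)) \<in> r \<longleftrightarrow>
      (\<exists>(i :: nat) (j :: nat). t \<otimes> w k \<otimes> b \<otimes> a [^] i = s \<otimes> w l \<otimes> b \<otimes> a [^] j)"
    if "k < n" "t \<in> carrier G" "l < n" "s \<in> carrier G" for k t l s
  proof -
    have "((k, t), (l, s)) \<in> r \<longleftrightarrow> r `` {(k, t)} = r `` {(l, s)}"
      using that by (intro eq_equiv_class_iff[OF r_equiv, symmetric]) (simp_all add: N)
    also have "\<dots> \<longleftrightarrow> \<phi> (r `` {(k, t)}) = \<phi> (r `` {(l, s)})"
      using that by (intro inj_on_eq_iff[OF bij_betw_imp_inj_on[OF \<phi>_bij], symmetric])
        (simp_all add: N quotientI)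
    also have "\<dots> \<longleftrightarrow> (\<exists>(i :: nat) (j :: nat). t \<otimes> w k \<otimes> b \<otimes> a [^] i = s \<otimes> w l \<otimes> b \<otimes> a [^] j)"
      using that w b by (simp add: \<phi>_cls cls_eq)
    finally show ?thesis .
  qed

  \<comment> \<open>The generator \<open>b\<close> of the subact in terms of the generators of the presentation.\<close>
  have "cls b \<in> B"
    unfolding B_def by (rule subsetD[OF hull_subset]) simp
  then have "cls b \<in> \<phi> ` (N // r)"
    using \<phi>_bij by (simp add: bij_betw_def)
  then obtain k\<^sub>0 s\<^sub>0 where ks: "k\<^sub>0 < n" "s\<^sub>0 \<in> carrier G" and "cls b = \<phi> (r `` {(k\<^sub>0, s\<^sub>0)})"
    by (auto elim!: quotientE simp: N)
  then have "cls b = cls (s\<^sub>0 \<otimes> w k\<^sub>0 \<otimes> b)"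
    by (simp add: \<phi>_cls)
  then obtain i j :: nat where "b \<otimes> a [^] i = s\<^sub>0 \<otimes> w k\<^sub>0 \<otimes> b \<otimes> a [^] j"
    using ks w b by (auto simp: cls_eq)

  \<comment> \<open>A level at which this equation and all the defining relations are visible.\<close>
  then have base: "\<forall>\<^sub>F m in sequentially. \<exists>m' :: nat. b \<otimes> a [^] m = s\<^sub>0 \<otimes> w k\<^sub>0 \<otimes> b \<otimes> a [^] m'"
    using ks w b a by (intro eventually_common_tail) auto
  let ?visible = "\<lambda>(m :: nat) k t l s. \<exists>m' :: nat. t \<otimes> w k \<otimes> b \<otimes> a [^] m = s \<otimes> w l \<otimes> b \<otimes> a [^] m'"
  have "\<forall>\<^sub>F m in sequentially. \<forall>((k, t), (l, s))\<in>H. ?visible m k t l s \<and> ?visible m l s k t"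
  proof (rule eventually_ball_finite[OF H(1)], rule ballI)
    fix p assume p: "p \<in> H"
    obtain k t l s where p_eq: "p = ((k, t), (l, s))"
      by (cases p) auto
    have car: "k < n" "t \<in> carrier G" "l < n" "s \<in> carrier G"
      using H(2) p by (auto simp: p_eq N)
    have "((k, t), (l, s)) \<in> r"
      using p unfolding p_eq H(3) by (rule subsetD[OF hull_subset])
    then obtain i j :: nat where "t \<otimes> w k \<otimes> b \<otimes> a [^] i = s \<otimes> w l \<otimes> b \<otimes> a [^] j"
      using r_iff car by blast
    then have "\<forall>\<^sub>F m in sequentially. ?visible m k t l s" "\<forall>\<^sub>F m in sequentially. ?visible m l s k t"
      using car w b a by (auto intro!: eventually_common_tail intro: sym)
    then show "\<forall>\<^sub>F m in sequentially.
        (\<lambda>((k, t), (l, s)). ?visible m k t l s \<and> ?visible m l s k t) p"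
      unfolding p_eq by (simp add: eventually_conj)
  qed
  with base have "\<forall>\<^sub>F m in sequentially. (\<exists>m' :: nat. b \<otimes> a [^] m = s\<^sub>0 \<otimes> w k\<^sub>0 \<otimes> b \<otimes> a [^] m') \<and>
      (\<forall>((k, t), (l, s))\<in>H. ?visible m k t l s \<and> ?visible m l s k t)"
    by (rule eventually_conj)
  from eventually_happens'[OF sequentially_bot this]
  obtain m :: nat where m_base: "\<exists>m' :: nat. b \<otimes> a [^] m = s\<^sub>0 \<otimes> w k\<^sub>0 \<otimes> b \<otimes> a [^] m'"
    and m_all: "\<forall>((k, t), (l, s))\<in>H. ?visible m k t l s \<and> ?visible m l s k t"
    by blast
  have m_H: "?visible m k t l s" "?visible m l s k t" if "((k, t), (l, s)) \<in> H" for k t l s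
    using bspec[OF m_all that] by simp_all

  define T where "T = {(k, t) \<in> N. t \<otimes> w k \<otimes> b \<otimes> a [^] m = b \<otimes> a [^] m}"
  \<comment> \<open>Rigidity makes the two exponents in a visible relation agree as soon as a translate of one
    side is \<open>b \<otimes> a [^] m\<close>.\<close>
  have transfer: "(l, c \<otimes> s) \<in> T"
    if "?visible m k t l s" "(k, c \<otimes> t) \<in> T"
      "k < n" "t \<in> carrier G" "l < n" "s \<in> carrier G" "c \<in> carrier G" for k t l s c
  proof -
    from that(1) obtain m' :: nat
      where m': "t \<otimes> w k \<otimes> b \<otimes> a [^] m = s \<otimes> w l \<otimes> b \<otimes> a [^] m'"
      by blast
    have "b \<otimes> a [^] m = c \<otimes> (t \<otimes> w k \<otimes> b \<otimes> a [^] m)"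
      using that a b w by (simp add: T_def m_assoc)
    then have *: "b \<otimes> a [^] m = c \<otimes> (s \<otimes> w l \<otimes> b \<otimes> a [^] m')"
      by (simp only: m')
    then have "b \<otimes> a [^] m = (c \<otimes> s \<otimes> w l) \<otimes> (b \<otimes> a [^] m')"
      using that a b w by (simp add: m_assoc)
    then have "m = m'"
      using that w by (intro rigid) auto
    with * show ?thesis
      using that a b w by (simp add: T_def N m_assoc)
  qed
  have saturated: "x \<in> T \<longleftrightarrow> y \<in> T" if "(x, y) \<in> r" for x y
  proof (rule congruence_hull_saturated[OF free H(2) _ that[unfolded H(3)]])
    fix x y c assume xy: "(x, y) \<in> H" and c: "c \<in> carrier G"
    obtain k t l s where xy_eq: "x = (k, t)" "y = (l, s)"
      by (cases x, cases y) auto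
    have "k < n" "t \<in> carrier G" "l < n" "s \<in> carrier G"
      using xy H(2) by (auto simp: xy_eq N)
    then show "free_act G c x \<in> T \<longleftrightarrow> free_act G c y \<in> T"
      using transfer[OF m_H(1)] transfer[OF m_H(2)] xy c unfolding xy_eq free_act_def by auto
  qed

  have base_eq: "s\<^sub>0 \<otimes> w k\<^sub>0 \<otimes> b \<otimes> a [^] m = b \<otimes> a [^] m"
  proof -
    obtain m' :: nat where m': "b \<otimes> a [^] m = s\<^sub>0 \<otimes> w k\<^sub>0 \<otimes> b \<otimes> a [^] m'"
      using m_base by blast
    then have "m = m'"
      using ks w a b by (intro rigid[of "s\<^sub>0 \<otimes> w k\<^sub>0"]) (auto simp: m_assoc)
    with m' show ?thesis by simp
  qed
  obtain f where f: "f \<in> carrier G" "f \<otimes> (b \<otimes> a [^] Suc m) = b \<otimes> a [^] Suc m"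
    "f \<otimes> (b \<otimes> a [^] m) \<noteq> b \<otimes> a [^] m"
    using new by blast
  have f_mult: "f \<otimes> s\<^sub>0 \<otimes> w k\<^sub>0 \<otimes> b \<otimes> a [^] i = f \<otimes> (s\<^sub>0 \<otimes> w k\<^sub>0 \<otimes> b \<otimes> a [^] i)" for i :: nat
    using ks w a b f(1) by (simp add: m_assoc)
  have base_eq_Suc: "s\<^sub>0 \<otimes> w k\<^sub>0 \<otimes> b \<otimes> a [^] Suc m = b \<otimes> a [^] Suc m"
    using base_eq ks w a b mult_pow_add[of _ a m 1] by simp
  have "f \<otimes> s\<^sub>0 \<otimes> w k\<^sub>0 \<otimes> b \<otimes> a [^] Suc m = s\<^sub>0 \<otimes> w k\<^sub>0 \<otimes> b \<otimes> a [^] Suc m"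
    using f(2) by (simp only: f_mult base_eq_Suc)
  then have "((k\<^sub>0, f \<otimes> s\<^sub>0), (k\<^sub>0, s\<^sub>0)) \<in> r"
    using r_iff ks f(1) by blast
  moreover have "(k\<^sub>0, s\<^sub>0) \<in> T"
    using base_eq ks by (simp add: T_def N)
  moreover have "(k\<^sub>0, f \<otimes> s\<^sub>0) \<notin> T"
    using f(3) by (simp add: T_def f_mult base_eq)
  ultimately show False
    using saturated by blast
qed

end

section \<open>Submonoids of adequate monoids\<close>

text \<open>This turns pairwise incomparability into the rigidity assumption of the criterion above.\<close>

lemma L_tilde_le_left_mult:
  assumes "monoid F" "E \<subseteq> carrier F" "t \<in> carrier F" "y \<in> carrier F"
  shows "L_tilde_le F E (t \<otimes>\<^bsub>F\<^esub> y) y"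
  using assms by (auto simp: L_tilde_le_def monoid.m_assoc subset_iff)

theorem corollary4p11:
  fixes F (structure) and E M :: "'a set"
  assumes "monoid F"
    and "E \<subseteq> idempotents F"
    and "adequate F E"
    and "right_unitary F E"
    and "submonoid M F"
    and "\<And>t x e. \<lbrakk>t \<in> M; x \<in> M; e = t \<otimes> x; e = e \<otimes> e; e \<in> E\<rbrakk>
           \<Longrightarrow> e = plus_of F E t \<otimes> star_of F E x"
    and "\<exists>a\<in>M. \<exists>b\<in>M.
           (\<forall>i j :: nat. i \<noteq> j \<longrightarrow> \<not> L_tilde_le F E (b \<otimes> a [^] i) (b \<otimes> a [^] j)) \<and>
           (\<forall>i :: nat. M \<inter> ({f \<in> E. f \<otimes> (b \<otimes> a [^] (i + 1)) = b \<otimes> a [^] (i + 1)} -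
                            {f \<in> E. f \<otimes> (b \<otimes> a [^] i) = b \<otimes> a [^] i}) \<noteq> {})"
  shows "\<not> left_coherent (F\<lparr>carrier := M\<rparr>)"
proof -
  interpret F: monoid F by fact
  interpret M: monoid "F\<lparr>carrier := M\<rparr>"
    using assms(5,1) by (rule submonoid.submonoid_is_monoid)
  have M: "M \<subseteq> carrier F"
    using assms(5) by (rule submonoid.subset)
  have E: "E \<subseteq> carrier F"
    using assms(2) by (auto simp: idempotents_def)
  obtain a b where ab: "a \<in> M" "b \<in> M"
    and incomparable: "\<And>i j :: nat. i \<noteq> j \<Longrightarrow> \<not> L_tilde_le F E (b \<otimes> a [^] i) (b \<otimes> a [^] j)"
    and new: "\<And>i :: nat. M \<inter> ({f \<in> E. f \<otimes> (b \<otimes> a [^] (i + 1)) = b \<otimes> a [^] (i + 1)} -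
      {f \<in> E. f \<otimes> (b \<otimes> a [^] i) = b \<otimes> a [^] i}) \<noteq> {}"
    using assms(7) by blast
  have pow: "a [^]\<^bsub>F\<lparr>carrier := M\<rparr>\<^esub> i = a [^] i" for i :: nat
    by (simp add: nat_pow_def)
  show ?thesis
  proof (rule M.not_left_coherent_if_rigid_powers)
    show "a \<in> carrier (F\<lparr>carrier := M\<rparr>)" "b \<in> carrier (F\<lparr>carrier := M\<rparr>)"
      using ab by simp_all
  next
    fix n m :: nat and t
    assume "t \<in> carrier (F\<lparr>carrier := M\<rparr>)"
      and "b \<otimes>\<^bsub>F\<lparr>carrier := M\<rparr>\<^esub> a [^]\<^bsub>F\<lparr>carrier := M\<rparr>\<^esub> n =
        t \<otimes>\<^bsub>F\<lparr>carrier := M\<rparr>\<^esub> (b \<otimes>\<^bsub>F\<lparr>carrier := M\<rparr>\<^esub> a [^]\<^bsub>F\<lparr>carrier := M\<rparr>\<^esub> m)"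
    then have t: "t \<in> carrier F" and eq: "b \<otimes> a [^] n = t \<otimes> (b \<otimes> a [^] m)"
      using M by (auto simp: pow)
    have "b \<otimes> a [^] m \<in> carrier F"
      using ab M by auto
    then have "L_tilde_le F E (b \<otimes> a [^] n) (b \<otimes> a [^] m)"
      unfolding eq using assms(1) E t by (intro L_tilde_le_left_mult)
    then show "n = m"
      using incomparable by blast
  next
    fix n :: nat
    obtain f where "f \<in> M" "f \<otimes> (b \<otimes> a [^] Suc n) = b \<otimes> a [^] Suc n"
      "f \<otimes> (b \<otimes> a [^] n) \<noteq> b \<otimes> a [^] n"
      using new[of n] by auto
    then show "\<exists>f\<in>carrier (F\<lparr>carrier := M\<rparr>).
        f \<otimes>\<^bsub>F\<lparr>carrier := M\<rparr>\<^esub> (b \<otimes>\<^bsub>F\<lparr>carrier := M\<rparr>\<^esub> a [^]\<^bsub>F\<lparr>carrier := M\<rparr>\<^esub> Suc n) =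
          b \<otimes>\<^bsub>F\<lparr>carrier := M\<rparr>\<^esub> a [^]\<^bsub>F\<lparr>carrier := M\<rparr>\<^esub> Suc n \<and>
        f \<otimes>\<^bsub>F\<lparr>carrier := M\<rparr>\<^esub> (b \<otimes>\<^bsub>F\<lparr>carrier := M\<rparr>\<^esub> a [^]\<^bsub>F\<lparr>carrier := M\<rparr>\<^esub> n) \<noteq>
          b \<otimes>\<^bsub>F\<lparr>carrier := M\<rparr>\<^esub> a [^]\<^bsub>F\<lparr>carrier := M\<rparr>\<^esub> n"
      unfolding pow by auto
  qed
qed

end
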